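(* Let $\mathcal{C}^{mcd}$ be the family of all mutually completely dependent bivariate copulas, endowed with the metric $D_1$. Then $(\mathcal{C}^{mcd},D_1)$ is nowhere locally compact.
   Context: Nowhere locally compact means that no point has a compact neighbourhood. $\lambda$ is Lebesgue measure. A Borel measurable map $h:[0,1]\to[0,1]$ is $\lambda$-preserving if $\lambda(h^{-1}(E))=\lambda(E)$ for all $E\in\mathcal{B}([0,1])$. A bivariate copula is the restriction to $[0,1]^2$ of the distribution function of a probability measure on $[0,1]^2$ with both marginals equal to $\lambda$. For a copula $C$, $\mu_C$ denotes the corresponding doubly stochastic measure, $\mu_C([0,x]\times[0,y])=C(x,y)$, and $K_C:[0,1]\times\mathcal{B}([0,1])\to[0,1]$ denotes (a version of) its Markov kernel: $x\mapsto K_C(x,E)$ is Borel measurable for each Borel set $E$, $K_C(x,\cdot)$ is a probability measure for each $x$, and $\mu_C(G)=\int_{[0,1]}K_C(x,G_x)\,d\lambda(x)$ for every $G\in\mathcal{B}([0,1]^2)$, where $G_x=\{y:(x,y)\in G\}$. The kernel is unique for $\lambda$-a.e. $x$. The metric $D_1$ on copulas is $$D_1(C_1,C_2)=\int_{[0,1]}\int_{[0,1]}\big|K_{C_1}(x,[0,y])-K_{C_2}(x,[0,y])\big|\,d\lambda(x)\,d\lambda(y).$$ A copula $C$ is completely dependent if there is a $\lambda$-preserving $h:[0,1]\to[0,1]$ such that $K(x,E)=\mathbf{1}_E(h(x))$ is a Markov kernel of $C$; it is mutually completely dependent if $h$ can be chosen to be a $\lambda$-preserving bijection of $[0,1]$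 (i.e., $C$ and its transpose $C^t(x,y)=C(y,x)$ are both completely dependent). *)

theory Defs
  imports "HOL-Probability.Probability"
begin

text \<open>Lebesgue measure on the Borel sets of the unit interval.\<close>

definition unit_leb :: "real measure" where
  "unit_leb = restrict_space lborel {0..1}"

definition leb_preserving :: "(real \<Rightarrow> real) \<Rightarrow> bool" where
  "leb_preserving h \<longleftrightarrow>
     h \<in> measurable unit_leb unit_leb \<and>
     (\<forall>E\<in>sets unit_leb. emeasure unit_leb (h -` E \<inter> {0..1}) = emeasure unit_leb E)"

definition doubly_stochastic :: "(real \<times> real) measure \<Rightarrow> bool" where
  "doubly_stochastic \<mu> \<longleftrightarrow>
     prob_space \<mu> \<and> sets \<mu> = sets (unit_leb \<Otimes>\<^sub>M unit_leb) \<and>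
     distr \<mu> unit_leb fst = unit_leb \<and> distr \<mu> unit_leb snd = unit_leb"

text \<open>A copula is a function on the unit square only, so it is represented by an
  extensional function: two copulas are equal iff they agree on the square.\<close>

definition copulas :: "(real \<times> real \<Rightarrow> real) set" where
  "copulas = {restrict (\<lambda>(x, y). measure \<mu> ({0..x} \<times> {0..y})) ({0..1} \<times> {0..1}) | \<mu>.
                doubly_stochastic \<mu>}"

definition copula_measure :: "(real \<times> real \<Rightarrow> real) \<Rightarrow> (real \<times> real) measure" where
  "copula_measure C = (THE \<mu>. doubly_stochastic \<mu> \<and>
     (\<forall>x\<in>{0..1}. \<forall>y\<in>{0..1}. measure \<mu> ({0..x} \<times> {0..y}) = C (x, y)))"

definition markov_kernel_of :: "(real \<times> real \<Rightarrow> real) \<Rightarrow> (real \<Rightarrow> real measure) \<Rightarrow> bool" where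
  "markov_kernel_of C K \<longleftrightarrow>
     (\<forall>x\<in>{0..1}. prob_space (K x) \<and> sets (K x) = sets unit_leb) \<and>
     (\<forall>E\<in>sets unit_leb. (\<lambda>x. measure (K x) E) \<in> borel_measurable unit_leb) \<and>
     (\<forall>G\<in>sets (unit_leb \<Otimes>\<^sub>M unit_leb).
        emeasure (copula_measure C) G = (\<integral>\<^sup>+x. emeasure (K x) {y. (x, y) \<in> G} \<partial>unit_leb))"

text \<open>A version of the Markov kernel. It is unique only up to null sets, which do not
  affect the integral defining \<open>D1\<close>.\<close>

definition markov_kernel :: "(real \<times> real \<Rightarrow> real) \<Rightarrow> real \<Rightarrow> real measure" where
  "markov_kernel C = (SOME K. markov_kernel_of C K)"

definition D1 :: "(real \<times> real \<Rightarrow> real) \<Rightarrow> (real \<times> real \<Rightarrow> real) \<Rightarrow> real" where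
  "D1 C1 C2 =
     (LINT y|unit_leb. LINT x|unit_leb.
        \<bar>measure (markov_kernel C1 x) {0..y} - measure (markov_kernel C2 x) {0..y}\<bar>)"

text \<open>The kernel \<open>K(x, E) = 1\<^sub>E(h x)\<close> is the Dirac measure \<open>return unit_leb (h x)\<close>.\<close>

definition dependent_via :: "(real \<times> real \<Rightarrow> real) \<Rightarrow> (real \<Rightarrow> real) \<Rightarrow> bool" where
  "dependent_via C h \<longleftrightarrow>
     leb_preserving h \<and> markov_kernel_of C (\<lambda>x. return unit_leb (h x))"

definition completely_dependent :: "(real \<times> real \<Rightarrow> real) set" where
  "completely_dependent = {C \<in> copulas. \<exists>h. dependent_via C h}"

definition mutually_completely_dependent :: "(real \<times> real \<Rightarrow> real) set" where
  "mutually_completely_dependent =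
     {C \<in> copulas. \<exists>h. bij_betw h {0..1} {0..1} \<and> dependent_via C h}"

text \<open>No point has a compact neighbourhood; compare \<open>locally_compact_space\<close>.\<close>

definition nowhere_locally_compact_space :: "'a topology \<Rightarrow> bool" where
  "nowhere_locally_compact_space X \<longleftrightarrow>
     (\<forall>x\<in>topspace X. \<not> (\<exists>U K. openin X U \<and> compactin X K \<and> x \<in> U \<and> U \<subseteq> K))"

end

theory Submission
  imports Defs
begin

text \<open>
  A measure-preserving map \<open>h\<close> determines the completely dependent copula whose measure sits on
  the graph of \<open>h\<close>, and every mutually completely dependent copula arises in this way from a
  bijection. Its Markov kernel at \<open>x\<close> is the point mass at \<open>h x\<close>, with distribution function the
  step that jumps from 0 to 1 at \<open>h x\<close>. The area between two such steps is the distance of the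
  jump points, so Fubini's theorem turns \<open>D1\<close> into the \<open>L\<^sup>1\<close> distance of the two maps
  (\<open>D1_graph_copula\<close>). The metric axioms follow, since maps that agree almost everywhere have the
  same graph measure.

  The \<open>L\<^sup>1\<close> distance of \<open>f \<circ> h\<close> and \<open>g \<circ> h\<close> does not depend on the measure-preserving map
  \<open>h\<close> (\<open>D1_graph_copula_comp\<close>). To move away from an arbitrary copula it therefore suffices to
  compose its \<open>h\<close> with measure-preserving bijections near the identity, which are obtained as
  follows. For small \<open>c\<close> and \<open>A \<subseteq> [0, c)\<close>, exchange the points of \<open>A\<close> with those of the
  translate \<open>A + c\<close> and fix everything else. This involution moves no point by more than \<open>c\<close>, and
  the involutions for \<open>A\<close> and \<open>B\<close> differ by at least \<open>c\<close> on the symmetric difference of \<open>A\<close> and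
  \<open>B\<close>. Let \<open>A\<close> run through the sets of points of \<open>[0, c)\<close> whose \<open>n\<close>-th binary digit, relative to
  the length \<open>c\<close>, is 1: the digits are independent, so any two of these sets differ on a set of
  measure \<open>c / 2\<close>. Every ball thus contains an infinite sequence whose members have mutual
  distance at least \<open>c\<^sup>2 / 2\<close>, and such a ball does not fit into a totally bounded set, let alone
  into a compact one.
\<close>

section \<open>Lebesgue measure on the unit interval\<close>

lemma space_unit_leb [simp]: "space unit_leb = {0..1}"
  by (simp add: unit_leb_def space_restrict_space)

lemma sets_unit_leb: "sets unit_leb = {E \<in> sets borel. E \<subseteq> {0..1}}"
  unfolding unit_leb_def by (rule set_eqI) (simp add: sets_restrict_space_iff conj_commute)

lemma emeasure_unit_leb:
  "E \<in> sets unit_leb \<Longrightarrow> emeasure unit_leb E = emeasure lborel E"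
  unfolding unit_leb_def by (subst emeasure_restrict_space) (auto simp: sets_restrict_space_iff)

lemma prob_space_unit_leb: "prob_space unit_leb"
  by (rule prob_spaceI) (simp add: emeasure_unit_leb sets_unit_leb)

interpretation unit_leb: prob_space unit_leb
  by (rule prob_space_unit_leb)

lemma measurable_unit_leb_ident [measurable]: "(\<lambda>x. x) \<in> borel_measurable unit_leb"
  unfolding unit_leb_def by (rule measurable_restrict_space1) simp

section \<open>Copulas carried by graphs\<close>

definition clamp_unit :: "real \<Rightarrow> real" where
  "clamp_unit x = max 0 (min 1 x)"

lemma clamp_unit_measurable [measurable]: "clamp_unit \<in> measurable borel unit_leb"
  unfolding unit_leb_def by (rule measurable_restrict_space2) (auto simp: clamp_unit_def[abs_def])

text \<open>The quadrants \<open>{..(x, y)}\<close> form an intersection-stable generator of the Borel sets of the plane,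
  so the measures agree once they are pushed forward to the plane. Clamping both coordinates to the
  unit interval brings them back to the square, where it is the identity.\<close>

lemma doubly_stochastic_determined_by_rectangles:
  assumes \<mu>: "doubly_stochastic \<mu>" and \<nu>: "doubly_stochastic \<nu>"
    and eq: "\<And>x y. x \<in> {0..1} \<Longrightarrow> y \<in> {0..1} \<Longrightarrow>
      measure \<mu> ({0..x} \<times> {0..y}) = measure \<nu> ({0..x} \<times> {0..y})"
  shows "\<mu> = \<nu>"
proof -
  let ?P = "unit_leb \<Otimes>\<^sub>M unit_leb"
  let ?j = "\<lambda>p :: real \<times> real. (fst p, snd p)"
  let ?g = "\<lambda>p. (clamp_unit (fst p), clamp_unit (snd p))"
  have j: "?j \<in> borel_measurable ?P"
    unfolding borel_prod[symmetric] by measurable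
  have g: "?g \<in> measurable borel ?P"
    unfolding borel_prod[symmetric] by measurable
  have recover: "\<kappa> = distr (distr \<kappa> borel ?j) ?P ?g"
    and atMost: "emeasure (distr \<kappa> borel ?j) {..(x, y)} =
      (if x < 0 \<or> y < 0 then 0 else ennreal (measure \<kappa> ({0..min x 1} \<times> {0..min y 1})))"
    and fin: "emeasure (distr \<kappa> borel ?j) {..(x, y)} \<noteq> \<infinity>"
    if \<kappa>: "doubly_stochastic \<kappa>" for \<kappa> x y
  proof -
    interpret prob_space \<kappa> using \<kappa> by (simp add: doubly_stochastic_def)
    have s: "sets \<kappa> = sets ?P" using \<kappa> by (simp add: doubly_stochastic_def)
    have sp: "space \<kappa> = {0..1} \<times> {0..1}"
      using sets_eq_imp_space_eq[OF s] by (simp add: space_pair_measure)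
    have jm: "?j \<in> borel_measurable \<kappa>" using j by (simp cong: measurable_cong_sets add: s)
    have "distr (distr \<kappa> borel ?j) ?P ?g = distr \<kappa> ?P (?g \<circ> ?j)"
      by (rule distr_distr[OF g jm])
    also have "\<dots> = distr \<kappa> \<kappa> (\<lambda>p. p)"
      by (rule distr_cong) (auto simp: s sp clamp_unit_def)
    finally show "\<kappa> = distr (distr \<kappa> borel ?j) ?P ?g" by (simp add: distr_id2)
    have "?j -` {..(x, y)} \<inter> space \<kappa> =
        (if x < 0 \<or> y < 0 then {} else {0..min x 1} \<times> {0..min y 1})"
      by (auto simp: sp)
    moreover have "{..(x,y)} \<in> sets borel" by simp
    ultimately show "emeasure (distr \<kappa> borel ?j) {..(x, y)} =
      (if x < 0 \<or> y < 0 then 0 else ennreal (measure \<kappa> ({0..min x 1} \<times> {0..min y 1})))"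
      by (subst emeasure_distr[OF jm]) (auto simp: emeasure_eq_measure)
    show "emeasure (distr \<kappa> borel ?j) {..(x, y)} \<noteq> \<infinity>"
      by (subst emeasure_distr[OF jm]) (auto simp: emeasure_eq_measure)
  qed
  have "distr \<mu> borel ?j = distr \<nu> borel ?j"
  proof (rule measure_eqI_generator_eq)
    let ?E = "range (\<lambda>a :: real \<times> real. {..a})"
    have "{..a} \<inter> {..b} = {..inf a b}" for a b :: "real \<times> real"
      by auto
    then show "Int_stable ?E" unfolding Int_stable_def by blast
    show "?E \<subseteq> Pow UNIV" by simp
    show "emeasure (distr \<mu> borel ?j) X = emeasure (distr \<nu> borel ?j) X" if "X \<in> ?E" for X
    proof -
      obtain a b where X: "X = {..(a, b)}" using \<open>X \<in> ?E\<close> by auto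
      show ?thesis unfolding X atMost[OF \<mu>] atMost[OF \<nu>] using eq by auto
    qed
    show "sets (distr \<mu> borel ?j) = sigma_sets UNIV ?E"
      "sets (distr \<nu> borel ?j) = sigma_sets UNIV ?E"
      by (simp_all add: borel_eq_atMost)
    show "range (\<lambda>i::nat. {..(real i, real i)}) \<subseteq> ?E" by auto
    have "\<exists>i::nat. a \<le> real i \<and> b \<le> real i" for a b :: real
      by (meson max.bounded_iff real_arch_simple)
    then show "(\<Union>i::nat. {..(real i, real i)}) = UNIV" by auto
    show "emeasure (distr \<mu> borel ?j) {..(real i, real i)} \<noteq> \<infinity>" for i
      by (rule fin[OF \<mu>])
  qed
  then show ?thesis using recover[OF \<mu>] recover[OF \<nu>] by metis
qed

lemma copula_measure_eqI:
  assumes "doubly_stochastic \<mu>"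
    and "\<And>x y. x \<in> {0..1} \<Longrightarrow> y \<in> {0..1} \<Longrightarrow> measure \<mu> ({0..x} \<times> {0..y}) = C (x, y)"
  shows "copula_measure C = \<mu>"
  unfolding copula_measure_def
  by (rule the_equality) (use assms doubly_stochastic_determined_by_rectangles in auto)

text \<open>The definite description that defines \<open>copula_measure\<close> denotes on every copula: existence is the
  definition of a copula, uniqueness is the previous determination by rectangles.\<close>

lemma copula_measure_of_copula:
  assumes "C \<in> copulas"
  shows doubly_stochastic_copula_measure: "doubly_stochastic (copula_measure C)"
    and copula_eq_copula_measure:
      "C = restrict (\<lambda>(x, y). measure (copula_measure C) ({0..x} \<times> {0..y})) ({0..1} \<times> {0..1})"
proof -
  obtain \<mu> where \<mu>: "doubly_stochastic \<mu>"
    and C: "C = restrict (\<lambda>(x, y). measure \<mu> ({0..x} \<times> {0..y})) ({0..1} \<times> {0..1})"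
    using assms unfolding copulas_def by blast
  have eq: "copula_measure C = \<mu>"
    by (rule copula_measure_eqI[OF \<mu>]) (simp add: C)
  show "doubly_stochastic (copula_measure C)" using \<mu> by (simp add: eq)
  show "C = restrict (\<lambda>(x, y). measure (copula_measure C) ({0..x} \<times> {0..y})) ({0..1} \<times> {0..1})"
    unfolding eq by (rule C)
qed

lemma leb_preserving_iff_distr:
  "leb_preserving h \<longleftrightarrow> h \<in> measurable unit_leb unit_leb \<and> distr unit_leb unit_leb h = unit_leb"
proof (cases "h \<in> measurable unit_leb unit_leb")
  case h: True
  show ?thesis
  proof
    assume "leb_preserving h"
    then show "h \<in> measurable unit_leb unit_leb \<and> distr unit_leb unit_leb h = unit_leb"
      by (auto simp: leb_preserving_def emeasure_distr intro!: measure_eqI)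
  next
    assume *: "h \<in> measurable unit_leb unit_leb \<and> distr unit_leb unit_leb h = unit_leb"
    then have "emeasure unit_leb (h -` E \<inter> {0..1}) = emeasure unit_leb E"
      if "E \<in> sets unit_leb" for E
      using emeasure_distr[OF h that] by simp
    with h show "leb_preserving h" by (simp add: leb_preserving_def)
  qed
qed (simp add: leb_preserving_def)

definition graph_measure :: "(real \<Rightarrow> real) \<Rightarrow> (real \<times> real) measure" where
  "graph_measure h = distr unit_leb (unit_leb \<Otimes>\<^sub>M unit_leb) (\<lambda>x. (x, h x))"

definition graph_copula :: "(real \<Rightarrow> real) \<Rightarrow> real \<times> real \<Rightarrow> real" where
  "graph_copula h =
     restrict (\<lambda>(x, y). measure (graph_measure h) ({0..x} \<times> {0..y})) ({0..1} \<times> {0..1})"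

lemma doubly_stochastic_graph_measure:
  assumes "leb_preserving h"
  shows "doubly_stochastic (graph_measure h)"
proof -
  have h [measurable]: "h \<in> measurable unit_leb unit_leb"
    and d: "distr unit_leb unit_leb h = unit_leb"
    using assms by (auto simp: leb_preserving_iff_distr)
  show ?thesis
    unfolding doubly_stochastic_def graph_measure_def
    by (auto simp: distr_distr comp_def d distr_id2 intro!: unit_leb.prob_space_distr)
qed

text \<open>Integrating the point mass at \<open>h x\<close> over the section of \<open>G\<close> at \<open>x\<close> counts those \<open>x\<close> whose
  graph point lies in \<open>G\<close>, which is what the graph measure does.\<close>

lemma markov_kernel_of_return_iff:
  assumes h [measurable]: "h \<in> measurable unit_leb unit_leb"
    and ds: "doubly_stochastic (copula_measure C)"
  shows "markov_kernel_of C (\<lambda>x. return unit_leb (h x)) \<longleftrightarrow> copula_measure C = graph_measure h"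
proof -
  let ?P = "unit_leb \<Otimes>\<^sub>M unit_leb"
  have hr: "h x \<in> {0..1}" if "x \<in> {0..1}" for x
    using measurable_space[OF h] that by simp
  have graph: "(\<integral>\<^sup>+x. emeasure (return unit_leb (h x)) {y. (x, y) \<in> G} \<partial>unit_leb)
      = emeasure (graph_measure h) G" if G [measurable]: "G \<in> sets ?P" for G
  proof -
    have G': "(\<lambda>x. (x, h x)) -` G \<inter> {0..1} \<in> sets unit_leb"
      using measurable_sets[of "\<lambda>x. (x, h x)" unit_leb ?P G] G by simp
    have "{y. (x, y) \<in> G} \<in> sets unit_leb" for x
      using sets_Pair1[OF G, of x] by (simp add: vimage_def)
    then have "(\<integral>\<^sup>+x. emeasure (return unit_leb (h x)) {y. (x, y) \<in> G} \<partial>unit_leb)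
      = (\<integral>\<^sup>+x. indicator ((\<lambda>x. (x, h x)) -` G \<inter> {0..1}) x \<partial>unit_leb)"
      by (intro nn_integral_cong) (auto simp: indicator_def)
    also have "\<dots> = emeasure (graph_measure h) G"
      using G' by (simp add: graph_measure_def emeasure_distr)
    finally show ?thesis .
  qed
  have "(\<lambda>x. measure (return unit_leb (h x)) E) \<in> borel_measurable unit_leb"
    if E [measurable]: "E \<in> sets unit_leb" for E
    by (simp add: measure_return)
  moreover have "sets (copula_measure C) = sets ?P" "sets (graph_measure h) = sets ?P"
    using ds by (auto simp: doubly_stochastic_def graph_measure_def)
  moreover have "prob_space (return unit_leb (h x))" if "x \<in> {0..1}" for x
    using hr[OF that] by (intro prob_space_return) simp
  ultimately show ?thesis
    unfolding markov_kernel_of_def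
    by (auto simp: graph intro!: measure_eqI)
qed

lemma graph_copula_in_copulas:
  assumes "leb_preserving h"
  shows "graph_copula h \<in> copulas"
  using doubly_stochastic_graph_measure[OF assms] unfolding copulas_def graph_copula_def by blast

lemma copula_measure_graph_copula:
  assumes "leb_preserving h"
  shows "copula_measure (graph_copula h) = graph_measure h"
  by (rule copula_measure_eqI[OF doubly_stochastic_graph_measure[OF assms]])
    (simp add: graph_copula_def)

lemma dependent_via_iff:
  assumes "C \<in> copulas" "leb_preserving h"
  shows "dependent_via C h \<longleftrightarrow> C = graph_copula h"
proof
  assume "dependent_via C h"
  then have "copula_measure C = graph_measure h"
    using markov_kernel_of_return_iff[of h C] doubly_stochastic_copula_measure[OF assms(1)]
    by (auto simp: dependent_via_def leb_preserving_def)
  then show "C = graph_copula h"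
    using copula_eq_copula_measure[OF assms(1)] by (simp add: graph_copula_def)
next
  assume C: "C = graph_copula h"
  then show "dependent_via C h"
    using markov_kernel_of_return_iff[of h C] doubly_stochastic_copula_measure[OF assms(1)]
      copula_measure_graph_copula[OF assms(2)] assms(2)
    by (auto simp: dependent_via_def leb_preserving_def)
qed

lemma mutually_completely_dependent_eq:
  "mutually_completely_dependent =
    {graph_copula h | h. bij_betw h {0..1} {0..1} \<and> leb_preserving h}"
  unfolding mutually_completely_dependent_def
  using dependent_via_iff graph_copula_in_copulas
  by (auto simp: dependent_via_def)

section \<open>The metric as an \<open>L\<^sup>1\<close> distance\<close>

text \<open>Both the chosen kernel and the point masses are densities of the same measure
  \<open>A \<mapsto> \<mu> (A \<times> [0, y])\<close>, so they agree almost everywhere. The exceptional null set may depend on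
  \<open>y\<close>; this is harmless in \<open>D1\<close>, where the integral over \<open>x\<close> is taken for each \<open>y\<close>
  separately.\<close>

lemma markov_kernel_AE_step:
  assumes h: "leb_preserving h" and y: "y \<in> {0..1}"
  shows "(\<lambda>x. measure (markov_kernel (graph_copula h) x) {0..y}) \<in> borel_measurable unit_leb"
    and "AE x in unit_leb. measure (markov_kernel (graph_copula h) x) {0..y}
           = (if h x \<le> y then 1 else 0)"
proof -
  let ?K = "markov_kernel (graph_copula h)"
  let ?P = "unit_leb \<Otimes>\<^sub>M unit_leb"
  have hm [measurable]: "h \<in> measurable unit_leb unit_leb"
    using h by (simp add: leb_preserving_def)
  have hr: "h x \<in> {0..1}" if "x \<in> {0..1}" for x
    using measurable_space[OF hm] that by simp
  have "dependent_via (graph_copula h) h"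
    using dependent_via_iff[OF graph_copula_in_copulas[OF h] h] by simp
  then have ret: "markov_kernel_of (graph_copula h) (\<lambda>x. return unit_leb (h x))"
    by (simp add: dependent_via_def)
  then have K: "markov_kernel_of (graph_copula h) ?K"
    unfolding markov_kernel_def by (rule someI[of "markov_kernel_of (graph_copula h)"])
  have Y: "{0..y} \<in> sets unit_leb" using y by (auto simp: sets_unit_leb)
  show meas [measurable]: "(\<lambda>x. measure (?K x) {0..y}) \<in> borel_measurable unit_leb"
    using K Y by (simp add: markov_kernel_of_def)
  have density: "emeasure (density unit_leb (\<lambda>x. ennreal (measure (L x) {0..y}))) A
      = emeasure (copula_measure (graph_copula h)) (A \<times> {0..y})"
    if L: "markov_kernel_of (graph_copula h) L" and A: "A \<in> sets unit_leb" for L A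
  proof -
    have [measurable]: "(\<lambda>x. measure (L x) {0..y}) \<in> borel_measurable unit_leb"
      using L Y by (simp add: markov_kernel_of_def)
    have "emeasure (copula_measure (graph_copula h)) (A \<times> {0..y})
        = (\<integral>\<^sup>+x. emeasure (L x) {z. (x, z) \<in> A \<times> {0..y}} \<partial>unit_leb)"
      using L A Y by (simp add: markov_kernel_of_def)
    also have "\<dots> = (\<integral>\<^sup>+x. ennreal (measure (L x) {0..y}) * indicator A x \<partial>unit_leb)"
    proof (rule nn_integral_cong)
      fix x assume "x \<in> space unit_leb"
      then interpret prob_space "L x"
        using L by (simp add: markov_kernel_of_def)
      show "emeasure (L x) {z. (x, z) \<in> A \<times> {0..y}}
          = ennreal (measure (L x) {0..y}) * indicator A x"
        by (auto simp: indicator_def emeasure_eq_measure atLeastAtMost_def atLeast_def atMost_def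
            Collect_conj_eq)
    qed
    also have "\<dots> = emeasure (density unit_leb (\<lambda>x. ennreal (measure (L x) {0..y}))) A"
      using A by (simp add: emeasure_density)
    finally show ?thesis by simp
  qed
  have meas': "(\<lambda>x. measure (return unit_leb (h x)) {0..y}) \<in> borel_measurable unit_leb"
    using ret Y by (simp add: markov_kernel_of_def)
  have "AE x in unit_leb. ennreal (measure (?K x) {0..y})
      = ennreal (measure (return unit_leb (h x)) {0..y})"
    by (rule unit_leb.density_unique)
      (use meas meas' density[OF K] density[OF ret] in \<open>auto intro!: measure_eqI\<close>)
  then show "AE x in unit_leb. measure (?K x) {0..y} = (if h x \<le> y then 1 else 0)"
    using AE_space
  proof eventually_elim
    case (elim x)
    then have "measure (?K x) {0..y} = measure (return unit_leb (h x)) {0..y}"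
      by simp
    also have "\<dots> = (if h x \<le> y then 1 else 0)"
      using hr[of x] elim Y by (simp add: measure_return indicator_def)
    finally show ?case .
  qed
qed

lemma integral_step_difference:
  fixes a b :: real
  assumes "a \<in> {0..1}" "b \<in> {0..1}"
  shows "(LINT y|unit_leb. \<bar>(if a \<le> y then 1 else 0) - (if b \<le> y then 1 else 0)\<bar>) = \<bar>a - b\<bar>"
proof -
  have *: "(LINT y|unit_leb. \<bar>(if a \<le> y then 1 else 0) - (if b \<le> y then 1 else 0)\<bar>) = b - a"
    if "a \<in> {0..1}" "b \<in> {0..1}" "a \<le> b" for a b :: real
  proof -
    have S: "{a..<b} \<in> sets unit_leb" using that by (auto simp: sets_unit_leb)
    have "(LINT y|unit_leb. \<bar>(if a \<le> y then 1 else 0) - (if b \<le> y then 1 else 0)\<bar>)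
        = (LINT y|unit_leb. indicator {a..<b} y :: real)"
      using that(3) by (intro Bochner_Integration.integral_cong) (auto simp: indicator_def)
    also have "\<dots> = measure unit_leb {a..<b}"
      using sets.sets_into_space[OF S] by (simp add: Int_absorb2)
    also have "\<dots> = b - a"
      using that(3) by (simp add: measure_def emeasure_unit_leb[OF S])
    finally show ?thesis .
  qed
  show ?thesis
  proof (cases "a \<le> b")
    case True
    then show ?thesis using *[OF assms] by simp
  next
    case False
    then have "(LINT y|unit_leb. \<bar>(if b \<le> y then 1 else 0) - (if a \<le> y then 1 else 0)\<bar>) = a - b"
      using *[OF assms(2,1)] by simp
    with False show ?thesis by (simp add: abs_minus_commute)
  qed
qed

text \<open>After the kernels are replaced by steps, interchanging the two integrals leaves for each \<open>x\<close> the
  area between two steps.\<close>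

lemma D1_graph_copula:
  assumes h1: "leb_preserving h1" and h2: "leb_preserving h2"
  shows "D1 (graph_copula h1) (graph_copula h2) = (LINT x|unit_leb. \<bar>h1 x - h2 x\<bar>)"
proof -
  have m1: "h1 \<in> measurable unit_leb unit_leb" and m2: "h2 \<in> measurable unit_leb unit_leb"
    using assms by (auto simp: leb_preserving_def)
  have r: "h1 x \<in> {0..1}" "h2 x \<in> {0..1}" if "x \<in> {0..1}" for x
    using measurable_space[OF m1] measurable_space[OF m2] that by auto
  have [measurable]: "h1 \<in> borel_measurable unit_leb" "h2 \<in> borel_measurable unit_leb"
    using measurable_compose[OF m1 measurable_unit_leb_ident]
      measurable_compose[OF m2 measurable_unit_leb_ident] by auto
  interpret P: pair_prob_space unit_leb unit_leb ..
  let ?s = "\<lambda>x y. \<bar>(if h1 x \<le> y then 1 else 0) - (if h2 x \<le> y then 1 else 0)\<bar> :: real"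
  have "D1 (graph_copula h1) (graph_copula h2) = (LINT y|unit_leb. LINT x|unit_leb. ?s x y)"
    unfolding D1_def
  proof (rule Bochner_Integration.integral_cong[OF refl], rule integral_cong_AE)
    fix y assume "y \<in> space unit_leb"
    then have y: "y \<in> {0..1}" by simp
    note K1 = markov_kernel_AE_step[OF h1 y] and K2 = markov_kernel_AE_step[OF h2 y]
    note [measurable] = K1(1) K2(1)
    show "(\<lambda>x. \<bar>measure (markov_kernel (graph_copula h1) x) {0..y}
        - measure (markov_kernel (graph_copula h2) x) {0..y}\<bar>) \<in> borel_measurable unit_leb"
      by measurable
    show "(\<lambda>x. ?s x y) \<in> borel_measurable unit_leb" by measurable
    show "AE x in unit_leb. \<bar>measure (markov_kernel (graph_copula h1) x) {0..y}
        - measure (markov_kernel (graph_copula h2) x) {0..y}\<bar> = ?s x y"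
      using K1(2) K2(2) by eventually_elim simp
  qed
  also have "\<dots> = (LINT x|unit_leb. LINT y|unit_leb. ?s x y)"
  proof (rule P.Fubini_integral)
    show "integrable (unit_leb \<Otimes>\<^sub>M unit_leb) (case_prod ?s)"
      by (rule P.integrable_const_bound[where B = 1]) auto
  qed
  also have "\<dots> = (LINT x|unit_leb. \<bar>h1 x - h2 x\<bar>)"
    using r by (intro Bochner_Integration.integral_cong refl integral_step_difference) auto
  finally show ?thesis .
qed

lemma leb_preserving_integrable:
  assumes "leb_preserving h"
  shows "integrable unit_leb h"
proof (rule unit_leb.integrable_const_bound[where B = 1])
  have m: "h \<in> measurable unit_leb unit_leb"
    using assms by (simp add: leb_preserving_def)
  show "h \<in> borel_measurable unit_leb"
    using measurable_compose[OF m measurable_unit_leb_ident] by simp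
  have "\<bar>h x\<bar> \<le> 1" if "x \<in> {0..1}" for x
    using measurable_space[OF m] that by fastforce
  then show "AE x in unit_leb. norm (h x) \<le> 1"
    by (intro AE_I2) simp
qed

lemma graph_copula_cong_AE:
  assumes "leb_preserving h1" "leb_preserving h2" "AE x in unit_leb. h1 x = h2 x"
  shows "graph_copula h1 = graph_copula h2"
proof -
  have [measurable]: "h1 \<in> measurable unit_leb unit_leb" "h2 \<in> measurable unit_leb unit_leb"
    using assms by (auto simp: leb_preserving_def)
  have "graph_measure h1 = graph_measure h2"
    unfolding graph_measure_def using assms(3) by (intro distr_cong_AE) auto
  then show ?thesis by (simp add: graph_copula_def)
qed

text \<open>Only the identity of indiscernibles needs more than the properties of the \<open>L\<^sup>1\<close> seminorm: distance
  zero makes the maps equal almost everywhere, and the copula is an invariant of this equivalence.\<close>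

lemma Metric_space_mutually_completely_dependent:
  "Metric_space mutually_completely_dependent D1"
proof
  show "0 \<le> D1 C1 C2" for C1 C2
    unfolding D1_def by (intro Bochner_Integration.integral_nonneg) auto
  show "D1 C1 C2 = D1 C2 C1" for C1 C2
    unfolding D1_def by (simp add: abs_minus_commute)
next
  fix C1 C2 assume "C1 \<in> mutually_completely_dependent" "C2 \<in> mutually_completely_dependent"
  then obtain h1 h2 where h: "leb_preserving h1" "leb_preserving h2"
    and C: "C1 = graph_copula h1" "C2 = graph_copula h2"
    unfolding mutually_completely_dependent_eq by auto
  have "integrable unit_leb (\<lambda>x. \<bar>h1 x - h2 x\<bar>)"
    using h by (intro integrable_abs Bochner_Integration.integrable_diff leb_preserving_integrable)
  then have "D1 C1 C2 = 0 \<longleftrightarrow> (AE x in unit_leb. \<bar>h1 x - h2 x\<bar> = 0)"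
    unfolding C D1_graph_copula[OF h] by (intro integral_nonneg_eq_0_iff_AE) auto
  also have "\<dots> \<longleftrightarrow> (AE x in unit_leb. h1 x = h2 x)" by simp
  finally have *: "D1 C1 C2 = 0 \<longleftrightarrow> (AE x in unit_leb. h1 x = h2 x)" .
  show "D1 C1 C2 = 0 \<longleftrightarrow> C1 = C2"
  proof
    assume "D1 C1 C2 = 0"
    then have "AE x in unit_leb. h1 x = h2 x" using * by blast
    then show "C1 = C2" unfolding C by (rule graph_copula_cong_AE[OF h])
  next
    assume "C1 = C2"
    then have "D1 C1 C2 = D1 C1 C1" by simp
    also have "\<dots> = 0" unfolding D1_def by simp
    finally show "D1 C1 C2 = 0" .
  qed
next
  fix C1 C2 C3 assume "C1 \<in> mutually_completely_dependent" "C2 \<in> mutually_completely_dependent"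
    "C3 \<in> mutually_completely_dependent"
  then obtain h1 h2 h3 where h: "leb_preserving h1" "leb_preserving h2" "leb_preserving h3"
    and C: "C1 = graph_copula h1" "C2 = graph_copula h2" "C3 = graph_copula h3"
    unfolding mutually_completely_dependent_eq by auto
  note int = integrable_abs[OF Bochner_Integration.integrable_diff[OF
        leb_preserving_integrable leb_preserving_integrable]]
  have "(LINT x|unit_leb. \<bar>h1 x - h3 x\<bar>)
      \<le> (LINT x|unit_leb. \<bar>h1 x - h2 x\<bar> + \<bar>h2 x - h3 x\<bar>)"
    using h by (intro integral_mono Bochner_Integration.integrable_add int) auto
  also have "\<dots> = (LINT x|unit_leb. \<bar>h1 x - h2 x\<bar>) + (LINT x|unit_leb. \<bar>h2 x - h3 x\<bar>)"
    using h by (intro Bochner_Integration.integral_add int)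
  finally show "D1 C1 C3 \<le> D1 C1 C2 + D1 C2 C3"
    using h by (simp add: C D1_graph_copula)
qed

section \<open>Separated sequences and local compactness\<close>

text \<open>A compact set is totally bounded, hence covered by finitely many balls of radius \<open>\<delta> / 2\<close>; by
  the pigeonhole principle two members of the sequence share one of them and are too close.\<close>

lemma (in Metric_space) nowhere_locally_compact_if_separated_sequences:
  assumes sep: "\<And>x \<epsilon>. x \<in> M \<Longrightarrow> \<epsilon> > 0 \<Longrightarrow>
    \<exists>\<sigma> \<delta>. \<delta> > 0 \<and> range \<sigma> \<subseteq> mball x \<epsilon> \<and> (\<forall>n m :: nat. n < m \<longrightarrow> \<delta> \<le> d (\<sigma> n) (\<sigma> m))"
  shows "nowhere_locally_compact_space mtopology"
  unfolding nowhere_locally_compact_space_def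
proof (intro ballI notI)
  fix x assume "x \<in> topspace mtopology"
  then have x: "x \<in> M" by simp
  assume "\<exists>U K. openin mtopology U \<and> compactin mtopology K \<and> x \<in> U \<and> U \<subseteq> K"
  then obtain U K where U: "openin mtopology U" "x \<in> U" "U \<subseteq> K" and K: "compactin mtopology K"
    by blast
  obtain \<epsilon> where \<epsilon>: "\<epsilon> > 0" "mball x \<epsilon> \<subseteq> U"
    using U by (auto simp: openin_mtopology)
  obtain \<sigma> :: "nat \<Rightarrow> 'a" and \<delta> where \<delta>: "\<delta> > 0" and ran: "range \<sigma> \<subseteq> mball x \<epsilon>"
    and far: "\<And>n m. n < m \<Longrightarrow> \<delta> \<le> d (\<sigma> n) (\<sigma> m)"
    using sep[OF x \<epsilon>(1)] by blast
  obtain F where F: "finite F" "F \<subseteq> K" "K \<subseteq> (\<Union>z\<in>F. mball z (\<delta> / 2))"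
    using compactin_imp_mtotally_bounded[OF K] \<delta> unfolding mtotally_bounded_def
    by (meson half_gt_zero)
  have "\<forall>n. \<exists>z. z \<in> F \<and> \<sigma> n \<in> mball z (\<delta> / 2)"
    using F(3) ran \<epsilon>(2) U(3) by blast
  then obtain z where z: "\<And>n. z n \<in> F" "\<And>n. \<sigma> n \<in> mball (z n) (\<delta> / 2)"
    by metis
  have "\<not> inj z"
    using z(1) F(1) by (meson finite_subset image_subsetI infinite_UNIV_nat finite_imageD)
  then obtain n m where nm: "n < m" "z n = z m"
    by (metis injI linorder_neqE_nat)
  have "d (\<sigma> n) (\<sigma> m) \<le> d (\<sigma> n) (z n) + d (z n) (\<sigma> m)"
    using z(2)[of n] z(2)[of m] by (intro triangle) auto
  also have "\<dots> < \<delta>"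
    using z(2)[of n] z(2)[of m] nm(2) by (auto simp: commute)
  finally show False using far[OF nm(1)] by simp
qed

section \<open>Binary digits\<close>

lemma emeasure_lborel_translate:
  fixes c :: real
  assumes "S \<in> sets borel"
  shows "emeasure lborel {x. x + c \<in> S} = emeasure lborel S"
proof -
  have "emeasure lborel S = emeasure (distr lborel borel ((+) c)) S"
    by (simp add: lborel_distr_plus)
  also have "\<dots> = emeasure lborel {x. x + c \<in> S}"
    using assms by (subst emeasure_distr) (auto simp: vimage_def add.commute)
  finally show ?thesis by simp
qed

text \<open>The points of \<open>[0, c)\<close> for which the \<open>n\<close>-th binary digit of \<open>x / c\<close> is 1; the set
  \<open>dyadic_set c 0\<close> is empty.\<close>

definition dyadic_set :: "real \<Rightarrow> nat \<Rightarrow> real set" where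
  "dyadic_set c n = {x \<in> {0..<c}. odd \<lfloor>2 ^ n * x / c\<rfloor>}"

lemma dyadic_set_measurable: "dyadic_set c n \<in> sets borel"
  unfolding dyadic_set_def by measurable

text \<open>Adding or subtracting \<open>c / 2 ^ m\<close> according to the \<open>m\<close>-th digit of \<open>x\<close> flips that digit without a
  carry, so all earlier digits survive. In terms of \<open>j = \<lfloor>2 ^ m * x / c\<rfloor>\<close> the move exchanges the even
  number \<open>2 i\<close> with \<open>2 i + 1\<close>, and the digits before the \<open>m\<close>-th one depend on \<open>j div 2\<close> only.\<close>

lemma dyadic_digit_of_neighbour:
  fixes c x s :: real
  assumes c: "c > 0" and nm: "n < m" and x: "x \<in> {0..<c}"
    and s: "s = (if odd \<lfloor>2 ^ m * x / c\<rfloor> then - c / 2 ^ m else c / 2 ^ m)"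
  shows "x + s \<in> {0..<c}"
    and "odd \<lfloor>2 ^ m * (x + s) / c\<rfloor> \<longleftrightarrow> even \<lfloor>2 ^ m * x / c\<rfloor>"
    and "\<lfloor>2 ^ n * (x + s) / c\<rfloor> = \<lfloor>2 ^ n * x / c\<rfloor>"
proof -
  define j where "j = \<lfloor>2 ^ m * x / c\<rfloor>"
  define k where "k = (if odd j then j - 1 else j + 1)"
  have "2 ^ m * (x + s) / c = 2 ^ m * x / c + of_int (k - j)"
    using c by (auto simp: s k_def j_def field_simps)
  then have k: "\<lfloor>2 ^ m * (x + s) / c\<rfloor> = k"
    by (simp only: floor_add_int[symmetric]) (simp add: j_def)
  show "odd \<lfloor>2 ^ m * (x + s) / c\<rfloor> \<longleftrightarrow> even \<lfloor>2 ^ m * x / c\<rfloor>"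
    unfolding k j_def[symmetric] by (simp add: k_def)
  \<comment> \<open>Membership in the interval can be read off the integer part, so it is preserved because
    \<open>2 ^ m\<close> is even.\<close>
  have range: "z \<in> {0..<c} \<longleftrightarrow> 0 \<le> \<lfloor>2 ^ m * z / c\<rfloor> \<and> \<lfloor>2 ^ m * z / c\<rfloor> < 2 ^ m" for z
  proof -
    have "\<lfloor>2 ^ m * z / c\<rfloor> < 2 ^ m \<longleftrightarrow> 2 ^ m * z / c < 2 ^ m"
      by (simp add: floor_less_iff)
    also have "\<dots> \<longleftrightarrow> z < c" using c by (simp add: field_simps)
    finally have upper: "\<lfloor>2 ^ m * z / c\<rfloor> < 2 ^ m \<longleftrightarrow> z < c" .
    have "(2::real) ^ m > 0" by simp
    then have "0 \<le> \<lfloor>2 ^ m * z / c\<rfloor> \<longleftrightarrow> 0 \<le> z"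
      using c by (simp add: zero_le_divide_iff zero_le_mult_iff del: zero_less_power)
    with upper show ?thesis by auto
  qed
  have "even ((2::int) ^ m)" using nm by simp
  then obtain q where q: "(2::int) ^ m = 2 * q" by (rule evenE)
  have "0 \<le> j" "j < 2 ^ m" using x range[of x] by (auto simp: j_def)
  then have "0 \<le> k" "k < 2 ^ m"
    by (auto simp: q k_def elim!: oddE evenE)
  then show "x + s \<in> {0..<c}" unfolding range k by simp
  obtain p where p: "m = n + Suc p" using nm less_imp_Suc_add by fastforce
  have digit: "\<lfloor>2 ^ n * z / c\<rfloor> = \<lfloor>2 ^ m * z / c\<rfloor> div 2 div 2 ^ p" for z
  proof -
    have "2 ^ n * z / c = (2 ^ m * z / c) / of_int (2 * 2 ^ p)"
      by (simp add: p power_add)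
    then have "\<lfloor>2 ^ n * z / c\<rfloor> = \<lfloor>(2 ^ m * z / c) / of_int (2 * 2 ^ p)\<rfloor>"
      by (simp only:)
    also have "\<dots> = \<lfloor>2 ^ m * z / c\<rfloor> div (2 * 2 ^ p)"
      by (rule floor_divide_real_eq_div) simp
    finally show ?thesis by (simp add: zdiv_zmult2_eq)
  qed
  have "k div 2 = j div 2" by (auto simp: k_def elim!: oddE evenE)
  then show "\<lfloor>2 ^ n * (x + s) / c\<rfloor> = \<lfloor>2 ^ n * x / c\<rfloor>"
    unfolding digit k by (simp add: j_def)
qed

text \<open>Flipping the \<open>m\<close>-th digit is piecewise a translation, and it maps the set \<open>Q\<close> where the digits
  \<open>n\<close> and \<open>m\<close> agree into the set \<open>D\<close> where they differ. Hence \<open>D\<close> has at least half of the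
  measure of \<open>[0, c)\<close>.\<close>

lemma dyadic_sets_separated:
  assumes c: "c > 0" and nm: "n < m"
  shows "ennreal (c / 2) \<le> emeasure lborel (sym_diff (dyadic_set c n) (dyadic_set c m))"
proof -
  define A where "A = dyadic_set c m"
  define D where "D = sym_diff (dyadic_set c n) A"
  define Q where "Q = {0..<c} - D"
  have A [measurable]: "A \<in> sets borel" and D [measurable]: "D \<in> sets borel"
    unfolding A_def D_def by (simp_all add: dyadic_set_measurable sets.Un sets.Diff)
  have Q [measurable]: "Q \<in> sets borel" unfolding Q_def by simp
  have inA: "x \<in> A \<longleftrightarrow> odd \<lfloor>2 ^ m * x / c\<rfloor>"
    and inD: "x \<in> D \<longleftrightarrow> odd \<lfloor>2 ^ n * x / c\<rfloor> \<noteq> odd \<lfloor>2 ^ m * x / c\<rfloor>"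
    if "x \<in> {0..<c}" for x
    using that by (auto simp: A_def D_def dyadic_set_def)
  have "D \<subseteq> {0..<c}" by (auto simp: A_def D_def dyadic_set_def)
  have down: "x + - c / 2 ^ m \<in> D - A" if "x \<in> Q \<inter> A" for x
  proof -
    have x: "x \<in> {0..<c}" using that by (simp add: Q_def)
    then have o: "odd \<lfloor>2 ^ m * x / c\<rfloor>" using inA that by blast
    then have "- c / 2 ^ m = (if odd \<lfloor>2 ^ m * x / c\<rfloor> then - c / 2 ^ m else c / 2 ^ m)" by simp
    note t = dyadic_digit_of_neighbour[OF c nm x this]
    show ?thesis
      using that t(2,3) o unfolding Diff_iff Q_def inD[OF t(1)] inA[OF t(1)] Int_iff inD[OF x]
      by simp
  qed
  have up: "x + c / 2 ^ m \<in> D \<inter> A" if "x \<in> Q - A" for x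
  proof -
    have x: "x \<in> {0..<c}" using that by (simp add: Q_def)
    then have o: "even \<lfloor>2 ^ m * x / c\<rfloor>" using inA that by blast
    then have "c / 2 ^ m = (if odd \<lfloor>2 ^ m * x / c\<rfloor> then - c / 2 ^ m else c / 2 ^ m)" by simp
    note t = dyadic_digit_of_neighbour[OF c nm x this]
    show ?thesis
      using that t(2,3) o unfolding Diff_iff Q_def inD[OF t(1)] inA[OF t(1)] Int_iff inD[OF x]
      by simp
  qed
  have split: "emeasure lborel X = emeasure lborel (X \<inter> A) + emeasure lborel (X - A)"
    if [measurable]: "X \<in> sets borel" for X
    by (subst plus_emeasure) (auto intro!: arg_cong[where f = "emeasure lborel"])
  have translate: "emeasure lborel X \<le> emeasure lborel Y"
    if "Y \<in> sets borel" "\<And>x. x \<in> X \<Longrightarrow> x + t \<in> Y" for X Y and t :: real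
  proof -
    have "{x. x + t \<in> Y} \<in> sets borel"
      using measurable_sets[of "\<lambda>x. x + t" borel borel Y] that(1) by (simp add: vimage_def)
    then have "emeasure lborel X \<le> emeasure lborel {x. x + t \<in> Y}"
      using that(2) by (intro emeasure_mono) auto
    then show ?thesis by (simp add: emeasure_lborel_translate[OF that(1)])
  qed
  have "emeasure lborel Q = emeasure lborel (Q \<inter> A) + emeasure lborel (Q - A)"
    by (rule split[OF Q])
  also have "\<dots> \<le> emeasure lborel (D - A) + emeasure lborel (D \<inter> A)"
    by (intro add_mono translate[OF _ down] translate[OF _ up] sets.Diff sets.Int A D)
  also have "\<dots> = emeasure lborel D"
    using split[OF D] by (simp add: add.commute)
  finally have QD: "emeasure lborel Q \<le> emeasure lborel D" .
  have "ennreal c = emeasure lborel (Q \<union> D)"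
    using \<open>D \<subseteq> {0..<c}\<close> c by (simp add: Q_def Un_absorb2)
  also have "\<dots> = emeasure lborel Q + emeasure lborel D"
    by (rule plus_emeasure[symmetric]) (auto simp: Q_def)
  also have "\<dots> \<le> emeasure lborel D + emeasure lborel D"
    using QD by (rule add_right_mono)
  finally have le: "ennreal c \<le> emeasure lborel D + emeasure lborel D" .
  have "ennreal (c / 2) \<le> emeasure lborel D"
  proof (rule ccontr)
    assume "\<not> ?thesis"
    then have "emeasure lborel D < ennreal (c / 2)" by simp
    then have "emeasure lborel D + emeasure lborel D < ennreal (c / 2) + ennreal (c / 2)"
      by (intro add_strict_mono)
    also have "\<dots> = ennreal c" using c by (simp flip: ennreal_plus)
    finally show False using le by simp
  qed
  then show ?thesis by (simp add: D_def A_def)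
qed

section \<open>Exchanging a set with its translate\<close>

definition swap_translate :: "real set \<Rightarrow> real \<Rightarrow> real \<Rightarrow> real" where
  "swap_translate A c x = (if x \<in> A then x + c else if x - c \<in> A then x - c else x)"

context
  fixes A :: "real set" and c :: real
  assumes A: "A \<in> sets borel" "A \<subseteq> {0..<c}" and c: "2 * c \<le> 1"
begin

lemma swap_translate_involution: "swap_translate A c (swap_translate A c x) = x"
proof -
  have "x + c \<notin> A" if "x \<in> A"
    using subsetD[OF A(2), of x] subsetD[OF A(2), of "x + c"] that by auto
  moreover have "x - c \<in> A \<Longrightarrow> x - c + c = x" by simp
  ultimately show ?thesis by (auto simp: swap_translate_def)
qed

lemma swap_translate_in_unit:
  assumes "x \<in> {0..1}"
  shows "swap_translate A c x \<in> {0..1}"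
proof -
  have "x + c \<in> {0..1}" if "x \<in> A" using subsetD[OF A(2) that] c by auto
  moreover have "x - c \<in> {0..1}" if "x - c \<in> A" using subsetD[OF A(2) that] c by auto
  ultimately show ?thesis using assms by (auto simp: swap_translate_def)
qed

lemma bij_betw_swap_translate: "bij_betw (swap_translate A c) {0..1} {0..1}"
  by (rule bij_betw_byWitness[where f' = "swap_translate A c"])
    (use swap_translate_involution swap_translate_in_unit in auto)

lemma swap_translate_measurable: "swap_translate A c \<in> measurable unit_leb unit_leb"
proof -
  note [measurable] = A(1)
  have "swap_translate A c \<in> borel_measurable borel"
    unfolding swap_translate_def[abs_def] by measurable
  then show ?thesis
    unfolding unit_leb_def using swap_translate_in_unit
    by (intro measurable_restrict_space2 measurable_restrict_space1)
      (auto simp: space_restrict_space)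
qed

text \<open>The preimage of \<open>E\<close> consists of a translate of \<open>E \<inter> (A + c)\<close>, a translate of \<open>E \<inter> A\<close> and
  the rest of \<open>E\<close>.\<close>

lemma leb_preserving_swap_translate: "leb_preserving (swap_translate A c)"
  unfolding leb_preserving_def
proof (intro conjI ballI swap_translate_measurable)
  fix E assume E: "E \<in> sets unit_leb"
  then have E' [measurable]: "E \<in> sets borel" and E01: "E \<subseteq> {0..1}"
    by (auto simp: sets_unit_leb)
  note [measurable] = A(1)
  let ?A' = "{x. x - c \<in> A}"
  have [measurable]: "?A' \<in> sets borel" by measurable
  have disj: "x - c \<notin> A" if "x \<in> A" for x
    using subsetD[OF A(2), of x] subsetD[OF A(2), of "x - c"] that by auto
  have up: "x + c \<in> {0..1}" "x \<in> {0..1}" if "x \<in> A" for x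
    using subsetD[OF A(2) that] c by auto
  have down: "x \<in> {0..1}" if "x - c \<in> A" for x
    using up[OF that] by simp
  have pre: "swap_translate A c -` E \<inter> {0..1} =
    {x. x + c \<in> E \<inter> ?A'} \<union> ({x. x + - c \<in> E \<inter> A} \<union> (E - A - ?A'))"
  proof (rule set_eqI)
    fix x
    consider "x \<in> A" | "x \<notin> A" "x - c \<in> A" | "x \<notin> A" "x - c \<notin> A" by blast
    then show "x \<in> swap_translate A c -` E \<inter> {0..1} \<longleftrightarrow>
        x \<in> {x. x + c \<in> E \<inter> ?A'} \<union> ({x. x + - c \<in> E \<inter> A} \<union> (E - A - ?A'))"
    proof cases
      case 1
      then show ?thesis using disj[of x] up[of x] by (simp add: swap_translate_def)
    next
      case 2
      then show ?thesis using down[of x] by (simp add: swap_translate_def)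
    next
      case 3
      then show ?thesis using E01 by (auto simp: swap_translate_def)
    qed
  qed
  have add3: "emeasure lborel (X \<union> (Y \<union> Z)) = emeasure lborel X + (emeasure lborel Y + emeasure lborel Z)"
    if "X \<in> sets borel" "Y \<in> sets borel" "Z \<in> sets borel"
      "X \<inter> Y = {}" "X \<inter> Z = {}" "Y \<inter> Z = {}" for X Y Z :: "real set"
    using that by (simp add: plus_emeasure Int_Un_distrib)
  have "emeasure unit_leb (swap_translate A c -` E \<inter> {0..1})
      = emeasure lborel (swap_translate A c -` E \<inter> {0..1})"
    using measurable_sets[OF swap_translate_measurable E] by (intro emeasure_unit_leb) simp
  also have "\<dots> = emeasure lborel {x. x + c \<in> E \<inter> ?A'} +
      (emeasure lborel {x. x + - c \<in> E \<inter> A} + emeasure lborel (E - A - ?A'))"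
    unfolding pre using disj by (intro add3) auto
  also have "\<dots> = emeasure lborel (E \<inter> ?A') + (emeasure lborel (E \<inter> A) + emeasure lborel (E - A - ?A'))"
    by (simp only: emeasure_lborel_translate E' A(1) sets.Int \<open>?A' \<in> sets borel\<close>)
  also have "\<dots> = emeasure lborel (E \<inter> ?A' \<union> (E \<inter> A \<union> (E - A - ?A')))"
    using disj by (intro add3[symmetric]) auto
  also have "E \<inter> ?A' \<union> (E \<inter> A \<union> (E - A - ?A')) = E" by auto
  finally show "emeasure unit_leb (swap_translate A c -` E \<inter> {0..1}) = emeasure unit_leb E"
    using E by (simp add: emeasure_unit_leb)
qed

end

lemma swap_translate_close:
  assumes "c \<ge> 0"
  shows "\<bar>swap_translate A c x - x\<bar> \<le> c"
  using assms by (simp add: swap_translate_def)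

text \<open>A point of only one of the two sets lies in \<open>[0, c)\<close>, so it is moved by \<open>c\<close> under one
  involution and belongs to neither translate, hence is fixed under the other.\<close>

lemma swap_translate_separates:
  assumes A: "A \<subseteq> {0..<c}" and B: "B \<subseteq> {0..<c}" and y: "y \<in> sym_diff A B"
  shows "c \<le> \<bar>swap_translate A c y - swap_translate B c y\<bar>"
proof -
  have y': "y \<in> {0..<c}" using A B y by auto
  then have "y - c \<notin> A" "y - c \<notin> B"
    using subsetD[OF A, of "y - c"] subsetD[OF B, of "y - c"] by auto
  then show ?thesis using y y' by (auto simp: swap_translate_def)
qed

section \<open>Separated sequences in small balls\<close>

lemma leb_preserving_comp:
  assumes "leb_preserving g" "leb_preserving h"
  shows "leb_preserving (g \<circ> h)"
  using assms unfolding leb_preserving_iff_distr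
  by (auto simp: distr_distr[symmetric] intro: measurable_comp)

text \<open>Composition with \<open>h\<close> on the inside is an isometry: substitute \<open>y = h x\<close> in the integral. This
  reduces the study of a neighbourhood of any copula to one of the identity map.\<close>

lemma D1_graph_copula_comp:
  assumes h: "leb_preserving h" and f: "leb_preserving f" and g: "leb_preserving g"
  shows "D1 (graph_copula (f \<circ> h)) (graph_copula (g \<circ> h)) = (LINT y|unit_leb. \<bar>f y - g y\<bar>)"
proof -
  have h': "h \<in> measurable unit_leb unit_leb" "distr unit_leb unit_leb h = unit_leb"
    using h by (auto simp: leb_preserving_iff_distr)
  have "integrable unit_leb (\<lambda>y. \<bar>f y - g y\<bar>)"
    using f g by (intro integrable_abs Bochner_Integration.integrable_diff leb_preserving_integrable)
  then have "(LINT y|distr unit_leb unit_leb h. \<bar>f y - g y\<bar>) = (LINT x|unit_leb. \<bar>f (h x) - g (h x)\<bar>)"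
    by (intro integral_distr h'(1)) auto
  then show ?thesis
    using assms by (simp add: D1_graph_copula leb_preserving_comp h'(2))
qed

lemma separated_swaps:
  assumes c: "0 < c" "2 * c \<le> 1" and nm: "n < m"
  shows "c * (c / 2) \<le> (LINT y|unit_leb. \<bar>swap_translate (dyadic_set c n) c y
    - swap_translate (dyadic_set c m) c y\<bar>)" (is "_ \<le> (LINT y|_. ?f y)")
proof -
  let ?D = "sym_diff (dyadic_set c n) (dyadic_set c m)"
  have sub: "dyadic_set c k \<subseteq> {0..<c}" for k by (auto simp: dyadic_set_def)
  note pres = leb_preserving_swap_translate[OF dyadic_set_measurable sub c(2)]
  have "?D \<subseteq> {0..<c}" using sub by blast
  also have "\<dots> \<subseteq> {0..1}" using c by auto
  finally have D: "?D \<in> sets unit_leb"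
    by (simp add: sets_unit_leb dyadic_set_measurable sets.Un sets.Diff)
  have "ennreal (c / 2) \<le> emeasure unit_leb ?D"
    using dyadic_sets_separated[OF c(1) nm] by (simp only: emeasure_unit_leb[OF D])
  then have "c / 2 \<le> measure unit_leb ?D"
    using c by (simp add: unit_leb.emeasure_eq_measure)
  then have "c * (c / 2) \<le> c * measure unit_leb ?D"
    using c by (intro mult_left_mono) auto
  also have "\<dots> = (LINT y|unit_leb. c * indicator ?D y)"
    using sets.sets_into_space[OF D] by (simp add: Int_absorb2)
  also have "\<dots> \<le> (LINT y|unit_leb. ?f y)"
  proof (rule integral_mono)
    show "integrable unit_leb (\<lambda>y. c * indicator ?D y)"
      using D by (intro integrable_mult_right) (simp add: unit_leb.emeasure_eq_measure)
    show "integrable unit_leb ?f"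
      using pres by (intro integrable_abs Bochner_Integration.integrable_diff leb_preserving_integrable)
    show "c * indicator ?D y \<le> ?f y" for y
      using swap_translate_separates[OF sub sub, of y] by (cases "y \<in> ?D") auto
  qed
  finally show ?thesis .
qed

theorem corollary4p4:
  "Metric_space mutually_completely_dependent D1 \<and>
   nowhere_locally_compact_space (Metric_space.mtopology mutually_completely_dependent D1)"
proof
  show metric: "Metric_space mutually_completely_dependent D1"
    by (rule Metric_space_mutually_completely_dependent)
  then interpret Metric_space mutually_completely_dependent D1 .
  show "nowhere_locally_compact_space mtopology"
  proof (rule nowhere_locally_compact_if_separated_sequences)
    fix C and \<epsilon> :: real assume C: "C \<in> mutually_completely_dependent" and \<epsilon>: "\<epsilon> > 0"
    obtain h where h: "leb_preserving h" "bij_betw h {0..1} {0..1}" and Ch: "C = graph_copula h"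
      using C unfolding mutually_completely_dependent_eq by auto
    \<comment> \<open>The first bound leaves room for \<open>[0, c)\<close> and its translate in the unit interval, the second
      keeps the perturbed copulas in the ball.\<close>
    define c where "c = min (1 / 2) (\<epsilon> / 2)"
    have c: "0 < c" "2 * c \<le> 1" "c < \<epsilon>" using \<epsilon> by (auto simp: c_def min_def)
    define s where "s n = swap_translate (dyadic_set c n) c" for n
    have sub: "dyadic_set c n \<subseteq> {0..<c}" for n by (auto simp: dyadic_set_def)
    have s: "leb_preserving (s n)" "bij_betw (s n) {0..1} {0..1}" for n
      unfolding s_def using leb_preserving_swap_translate[OF dyadic_set_measurable sub c(2)]
        bij_betw_swap_translate[OF dyadic_set_measurable sub c(2)] by auto
    define \<sigma> where "\<sigma> n = graph_copula (s n \<circ> h)" for n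
    have in_mcd: "\<sigma> n \<in> mutually_completely_dependent" for n
      unfolding mutually_completely_dependent_eq \<sigma>_def
      using bij_betw_trans[OF h(2) s(2)] leb_preserving_comp[OF s(1) h(1)] by blast
    have id: "leb_preserving (\<lambda>x. x)"
      unfolding leb_preserving_iff_distr by (simp add: distr_id2)
    have "D1 C (\<sigma> n) < \<epsilon>" for n
    proof -
      have "D1 C (\<sigma> n) = (LINT y|unit_leb. \<bar>y - s n y\<bar>)"
        using D1_graph_copula_comp[OF h(1) id s(1)] by (simp add: Ch \<sigma>_def comp_def)
      also have "\<dots> \<le> (LINT y|unit_leb. c)"
        using c(1) swap_translate_close[of c]
        by (intro integral_mono integrable_abs Bochner_Integration.integrable_diff
            leb_preserving_integrable[OF id] leb_preserving_integrable[OF s(1)])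
          (auto simp: s_def abs_minus_commute)
      also have "\<dots> = c" using unit_leb.prob_space by simp
      finally show ?thesis using c(3) by simp
    qed
    then have "range \<sigma> \<subseteq> mball C \<epsilon>" using C in_mcd by auto
    moreover have "c * (c / 2) \<le> D1 (\<sigma> n) (\<sigma> m)" if "n < m" for n m
      using separated_swaps[OF c(1,2) that] D1_graph_copula_comp[OF h(1) s(1) s(1)]
      by (simp add: \<sigma>_def s_def)
    moreover have "c * (c / 2) > 0" using c(1) by simp
    ultimately show "\<exists>\<sigma> \<delta>. \<delta> > 0 \<and> range \<sigma> \<subseteq> mball C \<epsilon> \<and>
        (\<forall>n m :: nat. n < m \<longrightarrow> \<delta> \<le> D1 (\<sigma> n) (\<sigma> m))"
      by blast
  qed
qed

end
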